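(* A good tropical triangle is classically convex in $Z=0$. That is, if $a,b,c\in\mathbb{T}\mathbb{P}^2$ are points with real coordinates that define a good tropical triangle, then the image of $\operatorname{span}(a,b,c)$ in $\mathbb{R}^2$ under $[x,y,z]\mapsto(x-z,y-z)$ is convex in the classical sense.
   Context: $\mathbb{T}=\mathbb{R}\cup\{-\infty\}$ with $\max$ as tropical addition and $+$ as tropical multiplication. $\mathbb{T}\mathbb{P}^2$ is the quotient of $\mathbb{T}^3\setminus\{(-\infty,-\infty,-\infty)\}$ by $(p_1,p_2,p_3)\sim(\lambda+p_1,\lambda+p_2,\lambda+p_3)$, $\lambda\in\mathbb{R}$. $\operatorname{span}(a,b,c)$ is the set of points represented by $\max\{\lambda_1+a,\lambda_2+b,\lambda_3+c\}$ with $\lambda_j\in\mathbb{T}$ not all $-\infty$. For $p=[p_1,p_2,p_3]$, the tropical line $L_p$ is the set of $[x_1,x_2,x_3]\in\mathbb{T}\mathbb{P}^2$ such that $\max_j(p_j+x_j)$ is attained at least twice. Put $$p\otimes q=[\max\{p_2+q_3,q_2+p_3\},\ \max\{p_1+q_3,q_1+p_3\},\ \max\{p_1+q_2,q_1+p_2\}].$$ The stable join of points $p,q$ is the line $pq=L_{p\otimes q}$, and the stable intersection of lines is the point $L_p\cap_{\mathrm{st}}L_q=p\otimes q$. Three points $a,b,c$ define a good tropical triangle (namely $\operatorname{span}(a,b,c)$) if $$ca\cap_{\mathrm{st}}ab=a,\quad ab\cap_{\mathrm{st}}bc=b,\quad bc\cap_{\mathrm{st}}ca=c.$$ *)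

theory Defs
  imports "HOL-Analysis.Analysis"
begin

section \<open>The tropical projective plane\<close>

text \<open>
  A tropical number is an extended real different from \<open>\<infinity>\<close>; on these, \<^const>\<open>max\<close> and \<open>+\<close> on
  \<^typ>\<open>ereal\<close> are the tropical operations, with \<open>-\<infinity> + x = -\<infinity>\<close>.
\<close>

definition trop_vec :: "ereal \<times> ereal \<times> ereal \<Rightarrow> bool" where
  "trop_vec = (\<lambda>(x, y, z). x \<noteq> \<infinity> \<and> y \<noteq> \<infinity> \<and> z \<noteq> \<infinity> \<and> \<not> (x = -\<infinity> \<and> y = -\<infinity> \<and> z = -\<infinity>))"

definition trop_scale :: "ereal \<Rightarrow> ereal \<times> ereal \<times> ereal \<Rightarrow> ereal \<times> ereal \<times> ereal" where
  "trop_scale l = (\<lambda>(x, y, z). (l + x, l + y, l + z))"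

definition trop_add ::
  "ereal \<times> ereal \<times> ereal \<Rightarrow> ereal \<times> ereal \<times> ereal \<Rightarrow> ereal \<times> ereal \<times> ereal" where
  "trop_add = (\<lambda>(x, y, z) (x', y', z'). (max x x', max y y', max z z'))"

definition trop_rel :: "ereal \<times> ereal \<times> ereal \<Rightarrow> ereal \<times> ereal \<times> ereal \<Rightarrow> bool" where
  "trop_rel u v \<longleftrightarrow> trop_vec u \<and> trop_vec v \<and> (\<exists>l::real. v = trop_scale (ereal l) u)"

lemma trop_scale_0 [simp]: "trop_scale (ereal 0) u = u"
  by (auto simp: trop_scale_def split: prod.splits)

lemma trop_scale_scale: "trop_scale l (trop_scale m u) = trop_scale (l + m) u"
  by (auto simp: trop_scale_def add.assoc split: prod.splits)

lemma trop_vec_scale: "trop_vec (trop_scale (ereal l) u) \<longleftrightarrow> trop_vec u"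
  by (cases u) (auto simp: trop_scale_def trop_vec_def)

quotient_type tp2 = "ereal \<times> ereal \<times> ereal" / partial: trop_rel
proof (rule part_equivpI)
  show "\<exists>u. trop_rel u u"
    by (rule exI[of _ "(0, 0, 0)"])
      (auto simp: trop_rel_def trop_vec_def intro!: exI[of _ 0] simp del: ereal_eq_0)
  show "symp trop_rel"
  proof (rule sympI)
    fix u v assume uv: "trop_rel u v"
    then obtain l :: real where "v = trop_scale (ereal l) u" by (auto simp: trop_rel_def)
    hence "u = trop_scale (ereal (-l)) v"
      by (simp add: trop_scale_scale)
    with uv show "trop_rel v u" unfolding trop_rel_def by blast
  qed
  show "transp trop_rel"
  proof (rule transpI)
    fix u v w assume "trop_rel u v" "trop_rel v w"
    thus "trop_rel u w"
      unfolding trop_rel_def by (metis plus_ereal.simps(1) trop_scale_scale)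
  qed
qed

lemma trop_rel_refl: "trop_rel u u \<longleftrightarrow> trop_vec u"
  by (auto simp: trop_rel_def intro!: exI[of _ 0])

lemma trop_rel_abs_eq: "trop_rel u v \<Longrightarrow> abs_tp2 u = abs_tp2 v"
  by (simp add: Quotient3_rel_abs[OF Quotient3_tp2])

lemma trop_vec_rep: "trop_vec (rep_tp2 p)"
  using Quotient3_rep_reflp[OF Quotient3_tp2, of p] by (simp add: trop_rel_refl)

lemma abs_rep_tp2 [simp]: "abs_tp2 (rep_tp2 p) = p"
  by (rule Quotient3_abs_rep[OF Quotient3_tp2])

lemma rep_abs_tp2: "trop_vec u \<Longrightarrow> \<exists>l::real. rep_tp2 (abs_tp2 u) = trop_scale (ereal l) u"
  using Quotient3_rep_abs[OF Quotient3_tp2, of u] trop_rel_refl[of u]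
  by (metis Quotient3_rel Quotient3_tp2 abs_rep_tp2 trop_rel_def trop_rel_refl trop_vec_rep)

lemma tp2_cases:
  obtains x y z where "p = abs_tp2 (x, y, z)" "trop_vec (x, y, z)"
  by (metis abs_rep_tp2 prod_cases3 trop_vec_rep)

definition real_point :: "tp2 \<Rightarrow> bool" where
  "real_point p \<longleftrightarrow> (\<exists>x y z :: real. p = abs_tp2 (ereal x, ereal y, ereal z))"

definition trop_span :: "tp2 \<Rightarrow> tp2 \<Rightarrow> tp2 \<Rightarrow> tp2 set" where
  "trop_span a b c =
    {abs_tp2 (trop_add (trop_scale l (rep_tp2 a))
                (trop_add (trop_scale m (rep_tp2 b)) (trop_scale n (rep_tp2 c)))) | l m n.
       l \<noteq> \<infinity> \<and> m \<noteq> \<infinity> \<and> n \<noteq> \<infinity> \<and> \<not> (l = -\<infinity> \<and> m = -\<infinity> \<and> n = -\<infinity>)}"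

text \<open>The span does not depend on the representatives chosen by \<^const>\<open>rep_tp2\<close>.\<close>

lemma trop_span_abs:
  assumes "trop_vec u" "trop_vec v" "trop_vec w"
  shows "trop_span (abs_tp2 u) (abs_tp2 v) (abs_tp2 w) =
    {abs_tp2 (trop_add (trop_scale l u) (trop_add (trop_scale m v) (trop_scale n w))) | l m n.
       l \<noteq> \<infinity> \<and> m \<noteq> \<infinity> \<and> n \<noteq> \<infinity> \<and> \<not> (l = -\<infinity> \<and> m = -\<infinity> \<and> n = -\<infinity>)}"
    (is "_ = ?R")
proof -
  obtain i j k :: real where *: "rep_tp2 (abs_tp2 u) = trop_scale (ereal i) u"
    "rep_tp2 (abs_tp2 v) = trop_scale (ereal j) v" "rep_tp2 (abs_tp2 w) = trop_scale (ereal k) w"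
    using rep_abs_tp2 assms by meson
  have inf: "x + ereal r = \<infinity> \<longleftrightarrow> x = \<infinity>" "x + ereal r = -\<infinity> \<longleftrightarrow> x = -\<infinity>" for x r
    by (cases x; simp)+
  have canc: "x + ereal (-r) + ereal r = x" for x r
    by (cases x) auto
  show ?thesis
  proof (intro equalityI subsetI)
    fix p assume "p \<in> trop_span (abs_tp2 u) (abs_tp2 v) (abs_tp2 w)"
    then obtain l m n where lmn: "p = abs_tp2 (trop_add (trop_scale (l + ereal i) u)
        (trop_add (trop_scale (m + ereal j) v) (trop_scale (n + ereal k) w)))"
      "l \<noteq> \<infinity>" "m \<noteq> \<infinity>" "n \<noteq> \<infinity>" "\<not> (l = -\<infinity> \<and> m = -\<infinity> \<and> n = -\<infinity>)"
      unfolding trop_span_def * trop_scale_scale by blast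
    show "p \<in> ?R"
      by (rule CollectI, rule exI[of _ "l + ereal i"], rule exI[of _ "m + ereal j"],
          rule exI[of _ "n + ereal k"]) (use lmn in \<open>simp add: inf\<close>)
  next
    fix p assume "p \<in> ?R"
    then obtain l m n where lmn: "p = abs_tp2 (trop_add (trop_scale l u)
        (trop_add (trop_scale m v) (trop_scale n w)))"
      "l \<noteq> \<infinity>" "m \<noteq> \<infinity>" "n \<noteq> \<infinity>" "\<not> (l = -\<infinity> \<and> m = -\<infinity> \<and> n = -\<infinity>)"
      by blast
    show "p \<in> trop_span (abs_tp2 u) (abs_tp2 v) (abs_tp2 w)"
      unfolding trop_span_def * trop_scale_scale
      by (rule CollectI, rule exI[of _ "l + ereal (-i)"], rule exI[of _ "m + ereal (-j)"],
          rule exI[of _ "n + ereal (-k)"])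
        (use lmn in \<open>simp only: inf canc simp_thms\<close>)
  qed
qed

lemma trop_span_real_point:
  assumes "real_point a" "real_point b" "real_point c" "p \<in> trop_span a b c"
  shows "real_point p"
proof -
  obtain a1 a2 a3 b1 b2 b3 c1 c2 c3 :: real where abc:
    "a = abs_tp2 (ereal a1, ereal a2, ereal a3)" "b = abs_tp2 (ereal b1, ereal b2, ereal b3)"
    "c = abs_tp2 (ereal c1, ereal c2, ereal c3)"
    using assms(1-3) unfolding real_point_def by blast
  have "trop_vec (ereal x, ereal y, ereal z)" for x y z
    by (simp add: trop_vec_def)
  with assms(4) obtain l m n where lmn:
    "p = abs_tp2 (trop_add (trop_scale l (ereal a1, ereal a2, ereal a3))
        (trop_add (trop_scale m (ereal b1, ereal b2, ereal b3))
          (trop_scale n (ereal c1, ereal c2, ereal c3))))"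
    "l \<noteq> \<infinity>" "m \<noteq> \<infinity>" "n \<noteq> \<infinity>" "\<not> (l = -\<infinity> \<and> m = -\<infinity> \<and> n = -\<infinity>)"
    unfolding abc by (subst (asm) trop_span_abs) auto
  have "\<exists>r::real. max (l + ereal x) (max (m + ereal y) (n + ereal z)) = ereal r" for x y z
    using lmn(2-5) by (cases l; cases m; cases n) (auto simp: max_def)
  with lmn(1) show ?thesis
    unfolding real_point_def trop_add_def trop_scale_def by (auto; metis)
qed

text \<open>Meaningful only on points with real coordinates, where it does not depend on the
  representative.\<close>

definition affine_chart :: "tp2 \<Rightarrow> real \<times> real" where
  "affine_chart p = (case rep_tp2 p of (x, y, z) \<Rightarrow>
     (real_of_ereal x - real_of_ereal z, real_of_ereal y - real_of_ereal z))"

lemma affine_chart_abs: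
  "affine_chart (abs_tp2 (ereal x, ereal y, ereal z)) = (x - z, y - z)"
proof -
  obtain l :: real where
    "rep_tp2 (abs_tp2 (ereal x, ereal y, ereal z)) = trop_scale (ereal l) (ereal x, ereal y, ereal z)"
    using rep_abs_tp2[of "(ereal x, ereal y, ereal z)"] by (auto simp: trop_vec_def)
  thus ?thesis by (simp add: affine_chart_def trop_scale_def)
qed


section \<open>Tropical lines, stable join and stable intersection\<close>

definition max_attained_twice :: "ereal \<Rightarrow> ereal \<Rightarrow> ereal \<Rightarrow> bool" where
  "max_attained_twice u v w \<longleftrightarrow> (let m = max u (max v w) in
     (u = m \<and> v = m) \<or> (u = m \<and> w = m) \<or> (v = m \<and> w = m))"

lemma max_attained_twice_shift:
  "max_attained_twice (ereal l + u) (ereal l + v) (ereal l + w) = max_attained_twice u v w"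
proof -
  have "max (ereal l + s) (ereal l + t) = ereal l + max s t" for s t
    by (cases s; cases t) (auto simp: max_def)
  moreover have "ereal l + s = ereal l + t \<longleftrightarrow> s = t" for s t
    by (cases s; cases t) auto
  ultimately show ?thesis by (simp add: max_attained_twice_def Let_def)
qed

lift_definition incident :: "tp2 \<Rightarrow> tp2 \<Rightarrow> bool" is
  "\<lambda>(p1, p2, p3) (x1, x2, x3). max_attained_twice (p1 + x1) (p2 + x2) (p3 + x3)"
proof -
  fix u v s t assume "trop_rel u v" "trop_rel s t"
  then obtain l m :: real where *: "v = trop_scale (ereal l) u" "t = trop_scale (ereal m) s"
    by (auto simp: trop_rel_def)
  have "ereal l + x + (ereal m + y) = ereal (l + m) + (x + y)" for x y
    by (metis ab_semigroup_add_class.add_ac(1) add.left_commute plus_ereal.simps(1))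
  then show "(case u of (p1, p2, p3) \<Rightarrow> \<lambda>(x1, x2, x3). max_attained_twice (p1 + x1) (p2 + x2) (p3 + x3)) s =
    (case v of (p1, p2, p3) \<Rightarrow> \<lambda>(x1, x2, x3). max_attained_twice (p1 + x1) (p2 + x2) (p3 + x3)) t"
    using * by (cases u; cases s) (simp add: trop_scale_def max_attained_twice_shift)
qed

definition trop_line :: "tp2 \<Rightarrow> tp2 set" where
  "trop_line p = {x. incident p x}"

definition trop_cross ::
  "ereal \<times> ereal \<times> ereal \<Rightarrow> ereal \<times> ereal \<times> ereal \<Rightarrow> ereal \<times> ereal \<times> ereal" where
  "trop_cross = (\<lambda>(p1, p2, p3) (q1, q2, q3).
     (max (p2 + q3) (q2 + p3), max (p1 + q3) (q1 + p3), max (p1 + q2) (q1 + p2)))"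

text \<open>
  If \<open>p = q\<close> has exactly one coordinate different from \<open>-\<infinity>\<close>, then \<open>trop_cross\<close> yields
  \<open>(-\<infinity>, -\<infinity>, -\<infinity>)\<close>, which represents no point, and \<open>stable_prod p q\<close> is an unspecified
  point. In all other cases it is given by the formula on representatives (see the lemma below).
\<close>

definition stable_prod :: "tp2 \<Rightarrow> tp2 \<Rightarrow> tp2" where
  "stable_prod p q = abs_tp2 (trop_cross (rep_tp2 p) (rep_tp2 q))"

lemma trop_cross_scale:
  "trop_cross (trop_scale (ereal l) u) (trop_scale (ereal m) v) =
     trop_scale (ereal (l + m)) (trop_cross u v)"
proof -
  have 1: "max (ereal k + s) (ereal k + t) = ereal k + max s t" for s t k
    by (cases s; cases t) (auto simp: max_def)
  have 2: "ereal l + x + (ereal m + y) = ereal (l + m) + (x + y)" for x y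
    by (metis ab_semigroup_add_class.add_ac(1) add.left_commute plus_ereal.simps(1))
  have 3: "ereal m + x + (ereal l + y) = ereal (l + m) + (x + y)" for x y
    by (metis 2 add.commute)
  show ?thesis
    by (cases u; cases v)
      (simp add: trop_cross_def trop_scale_def 1 2 3 del: plus_ereal.simps)
qed

lemma stable_prod_abs:
  assumes "trop_vec u" "trop_vec v" "trop_vec (trop_cross u v)"
  shows "stable_prod (abs_tp2 u) (abs_tp2 v) = abs_tp2 (trop_cross u v)"
proof -
  obtain l m :: real where "rep_tp2 (abs_tp2 u) = trop_scale (ereal l) u"
    "rep_tp2 (abs_tp2 v) = trop_scale (ereal m) v"
    using rep_abs_tp2 assms by blast
  hence "stable_prod (abs_tp2 u) (abs_tp2 v) = abs_tp2 (trop_scale (ereal (l + m)) (trop_cross u v))"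
    by (simp add: stable_prod_def trop_cross_scale del: plus_ereal.simps)
  also have "\<dots> = abs_tp2 (trop_cross u v)"
    by (rule trop_rel_abs_eq[symmetric])
      (use assms(3) in \<open>auto simp: trop_rel_def trop_vec_scale\<close>)
  finally show ?thesis .
qed

definition stable_join :: "tp2 \<Rightarrow> tp2 \<Rightarrow> tp2 set" where
  "stable_join p q = trop_line (stable_prod p q)"

text \<open>A tropical line determines the point \<open>p\<close> with \<open>L = trop_line p\<close> (lemma
  \<open>trop_line_inject\<close> below), so the descriptions are proper.\<close>

definition stable_inter :: "tp2 set \<Rightarrow> tp2 set \<Rightarrow> tp2" where
  "stable_inter L M = stable_prod (THE p. L = trop_line p) (THE q. M = trop_line q)"

lemma incident_abs:
  assumes "trop_vec (p1, p2, p3)" "trop_vec (x1, x2, x3)"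
  shows "incident (abs_tp2 (p1, p2, p3)) (abs_tp2 (x1, x2, x3)) \<longleftrightarrow>
    max_attained_twice (p1 + x1) (p2 + x2) (p3 + x3)"
  using assms by (subst incident.abs_eq) (auto simp: trop_rel_refl)

lemma trop_line_inject: "trop_line p = trop_line q \<longleftrightarrow> p = q"
proof
  assume eq: "trop_line p = trop_line q"
  obtain p1 p2 p3 where p: "p = abs_tp2 (p1, p2, p3)" "trop_vec (p1, p2, p3)" by (rule tp2_cases)
  obtain q1 q2 q3 where q: "q = abs_tp2 (q1, q2, q3)" "trop_vec (q1, q2, q3)" by (rule tp2_cases)
  have *: "max_attained_twice (p1 + x1) (p2 + x2) (p3 + x3) \<longleftrightarrow>
           max_attained_twice (q1 + x1) (q2 + x2) (q3 + x3)"
    if "trop_vec (x1, x2, x3)" for x1 x2 x3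
    using eq incident_abs[OF p(2) that] incident_abs[OF q(2) that] p(1) q(1)
    unfolding trop_line_def by blast
  have fin: "p1 \<noteq> \<infinity>" "p2 \<noteq> \<infinity>" "p3 \<noteq> \<infinity>" "q1 \<noteq> \<infinity>" "q2 \<noteq> \<infinity>" "q3 \<noteq> \<infinity>"
    using p(2) q(2) by (auto simp: trop_vec_def)
  have bot: "x + -\<infinity> = -\<infinity>" if "x \<noteq> \<infinity>" for x :: ereal
    using that by (cases x) auto
  have one: "max_attained_twice s (-\<infinity>) (-\<infinity>) \<longleftrightarrow> s = -\<infinity>"
    "max_attained_twice (-\<infinity>) s (-\<infinity>) \<longleftrightarrow> s = -\<infinity>"
    "max_attained_twice (-\<infinity>) (-\<infinity>) s \<longleftrightarrow> s = -\<infinity>" for s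
    by (auto simp: max_attained_twice_def Let_def max_def)
  have two: "max_attained_twice s t (-\<infinity>) \<longleftrightarrow> s = t"
    "max_attained_twice s (-\<infinity>) t \<longleftrightarrow> s = t"
    "max_attained_twice (-\<infinity>) s t \<longleftrightarrow> s = t" for s t
    by (auto simp: max_attained_twice_def Let_def max_def)
  have supp: "p1 = -\<infinity> \<longleftrightarrow> q1 = -\<infinity>" "p2 = -\<infinity> \<longleftrightarrow> q2 = -\<infinity>" "p3 = -\<infinity> \<longleftrightarrow> q3 = -\<infinity>"
    using *[of 0 "-\<infinity>" "-\<infinity>"] *[of "-\<infinity>" 0 "-\<infinity>"] *[of "-\<infinity>" "-\<infinity>" 0]
    by (simp_all add: fin bot one trop_vec_def)
  have cross: "q1 + p2 = q2 + p1" if "p1 \<noteq> -\<infinity>"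
    using *[of p2 p1 "-\<infinity>"] that by (simp add: fin bot two trop_vec_def add.commute)
  have cross2: "q1 + p3 = q3 + p1" if "p1 \<noteq> -\<infinity>"
    using *[of p3 "-\<infinity>" p1] that by (simp add: fin bot two trop_vec_def add.commute)
  have cross3: "q2 + p3 = q3 + p2" if "p2 \<noteq> -\<infinity>"
    using *[of "-\<infinity>" p3 p2] that by (simp add: fin bot two trop_vec_def add.commute)
  have solve: "s' = ereal (real_of_ereal (s - r)) + r'"
    if "s + r' = s' + r" "r \<noteq> \<infinity>" "r \<noteq> -\<infinity>" "s \<noteq> \<infinity>" "s \<noteq> -\<infinity>" "r' \<noteq> \<infinity>" "s' \<noteq> \<infinity>"
    for r s r' s' :: ereal
    using that by (cases r; cases s; cases r'; cases s'; simp)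
  have diag: "s = ereal (real_of_ereal (s - r)) + r"
    if "r \<noteq> \<infinity>" "r \<noteq> -\<infinity>" "s \<noteq> \<infinity>" "s \<noteq> -\<infinity>" for r s :: ereal
    using that by (cases r; cases s; simp)
  have "\<exists>l. (q1, q2, q3) = trop_scale (ereal l) (p1, p2, p3)"
  proof (cases "p1 = -\<infinity>")
    case False
    then show ?thesis
      using solve[OF cross] solve[OF cross2] diag[of p1 q1] fin supp
      unfolding trop_scale_def by auto
  next
    case p1: True
    show ?thesis
    proof (cases "p2 = -\<infinity>")
      case False
      then show ?thesis
        using solve[OF cross3] diag[of p2 q2] fin supp p1 unfolding trop_scale_def by auto
    next
      case True
      with p1 p(2) have "p3 \<noteq> -\<infinity>" by (auto simp: trop_vec_def)
      then show ?thesis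
        using diag[of p3 q3] fin supp p1 True unfolding trop_scale_def by auto
    qed
  qed
  hence "trop_rel (p1, p2, p3) (q1, q2, q3)"
    using p(2) q(2) unfolding trop_rel_def by blast
  thus "p = q" using p(1) q(1) trop_rel_abs_eq by simp
qed simp

lemma stable_inter_line: "stable_inter (trop_line p) (trop_line q) = stable_prod p q"
  by (simp add: stable_inter_def trop_line_inject)

definition good_trop_triangle :: "tp2 \<Rightarrow> tp2 \<Rightarrow> tp2 \<Rightarrow> bool" where
  "good_trop_triangle a b c \<longleftrightarrow>
     stable_inter (stable_join c a) (stable_join a b) = a \<and>
     stable_inter (stable_join a b) (stable_join b c) = b \<and>
     stable_inter (stable_join b c) (stable_join c a) = c"

end

theory Submission
  imports Defs
begin

text \<open>
  Represent points with real coordinates by vectors in \<open>\<real>\<^sup>3\<close> and say that \<open>p\<close> dominates \<open>q\<close> in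
  coordinate \<open>k\<close> if \<open>k\<close> is among the indices where \<open>p - q\<close> is largest. For fixed \<open>k\<close> this is a
  preorder, the sector of \<open>x\<close> in direction \<open>k\<close> being the set of its dominators. Two facts on tropical
  geometry translate the theorem into the language of these three preorders.

  \<^item> A point lies in the span of \<open>a\<close>, \<open>b\<close>, \<open>c\<close> iff in each coordinate it is dominated by one of the
    three (\<open>point_in_span_iff\<close>).
  \<^item> If the stable lines from \<open>p\<close> to \<open>q\<close> and from \<open>p\<close> to \<open>r\<close> meet stably in \<open>p\<close>, then \<open>q\<close> and \<open>r\<close>
    dominate \<open>p\<close> in two different coordinates (\<open>stable_vertex_separated\<close>). Otherwise both lines
    would leave \<open>p\<close> along the same ray, and their stable intersection would lie further out on it.

  The heart of the proof is a combinatorial consequence: in a good triangle, each of the three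
  preorders has a greatest vertex \<open>G k\<close> (\<open>separated_imp_greatest_vertex\<close>). A point dominated by
  some vertex in coordinate \<open>k\<close> is then dominated by \<open>G k\<close>, so the span consists of the points \<open>x\<close>
  that \<open>G k\<close> dominates in coordinate \<open>k\<close> for all \<open>k\<close>. This is no longer a union over the choices
  of dominating vertices but a single system of inequalities \<open>x\<^sub>j - x\<^sub>k \<ge> const\<close>, whose solution
  set is convex. The chart is linear on representatives, so it preserves convexity.
\<close>

section \<open>Points with real coordinates\<close>

definition point :: "real^3 \<Rightarrow> tp2" where
  "point x = abs_tp2 (ereal (x$1), ereal (x$2), ereal (x$3))"

definition cross_max :: "real^3 \<Rightarrow> real^3 \<Rightarrow> real^3" where
  "cross_max p q = vector [max (p$2 + q$3) (q$2 + p$3), max (p$1 + q$3) (q$1 + p$3),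
     max (p$1 + q$2) (q$1 + p$2)]"

lemma trop_vec_real: "trop_vec (ereal x, ereal y, ereal z)"
  by (simp add: trop_vec_def)

lemma real_point_iff: "real_point p \<longleftrightarrow> (\<exists>x. p = point x)"
proof
  assume "real_point p"
  then obtain x y z :: real where "p = abs_tp2 (ereal x, ereal y, ereal z)"
    by (auto simp: real_point_def)
  hence "p = point (vector [x, y, z])" by (simp add: point_def)
  thus "\<exists>x. p = point x" ..
qed (auto simp: real_point_def point_def)

lemma affine_chart_point: "affine_chart (point x) = (x$1 - x$3, x$2 - x$3)"
  by (simp add: point_def affine_chart_abs)

lemma stable_prod_point: "stable_prod (point p) (point q) = point (cross_max p q)"
proof -
  have "trop_cross (ereal (p$1), ereal (p$2), ereal (p$3)) (ereal (q$1), ereal (q$2), ereal (q$3)) =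
    (ereal (cross_max p q $ 1), ereal (cross_max p q $ 2), ereal (cross_max p q $ 3))"
    by (simp add: trop_cross_def cross_max_def ereal_max)
  thus ?thesis
    unfolding point_def by (simp add: stable_prod_abs trop_vec_real)
qed

lemma point_eqD:
  assumes "point x = point y"
  shows "x$i - x$j = y$i - y$j"
proof -
  have "x$1 - x$3 = y$1 - y$3" "x$2 - x$3 = y$2 - y$3"
    using arg_cong[OF assms, of affine_chart] by (simp_all add: affine_chart_point)
  thus ?thesis using exhaust_3[of i] exhaust_3[of j] by auto
qed

lemma index_cases:
  fixes i j k l :: 3
  assumes "i \<noteq> j" "i \<noteq> k" "j \<noteq> k"
  shows "l = i \<or> l = j \<or> l = k"
  using assms exhaust_3[of i] exhaust_3[of j] exhaust_3[of k] exhaust_3[of l] by auto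

lemma ex_other_indices:
  fixes i :: 3
  obtains j k where "i \<noteq> j" "i \<noteq> k" "j \<noteq> k"
proof -
  have "(1::3) \<noteq> 2" "(1::3) \<noteq> 3" "(2::3) \<noteq> 3" by simp_all
  thus ?thesis using exhaust_3[of i] that by metis
qed

text \<open>A form of the product that treats the coordinates alike, so that later arguments need no
  case distinction on indices.\<close>

lemma cross_max_nth:
  assumes "i \<noteq> j" "i \<noteq> k" "j \<noteq> k"
  shows "cross_max p q $ i = max (p$j + q$k) (p$k + q$j)"
  using assms exhaust_3[of i] exhaust_3[of j] exhaust_3[of k]
  by (auto simp: cross_max_def max.commute add.commute)


section \<open>Domination and the tropical span\<close>

definition dominates :: "3 \<Rightarrow> real^3 \<Rightarrow> real^3 \<Rightarrow> bool" where
  "dominates k p q \<longleftrightarrow> (\<forall>j. p$j - q$j \<le> p$k - q$k)"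

lemma dominates_refl: "dominates k p p"
  by (simp add: dominates_def)

lemma dominates_trans: "dominates k p q \<Longrightarrow> dominates k q r \<Longrightarrow> dominates k p r"
  unfolding dominates_def by (smt (verit))

text \<open>Mutual domination makes \<open>p - q\<close> constant: the two vectors represent the same point, and the
  coordinate no longer matters.\<close>

lemma dominates_antisym:
  assumes "dominates k p q" "dominates k q p"
  shows "dominates l p q"
proof -
  have "p$j - q$j = p$k - q$k" for j
    using assms[unfolded dominates_def, rule_format, of j] by linarith
  thus ?thesis unfolding dominates_def by (metis order_refl)
qed

lemma ex_dominates: "\<exists>k. dominates k p q"
proof -
  let ?D = "range (\<lambda>j. p$j - q$j)"
  have "Max ?D \<in> ?D" by (rule Max_in) auto
  then obtain k where "Max ?D = p$k - q$k" by (rule imageE)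
  moreover have "p$j - q$j \<le> Max ?D" for j by (rule Max_ge) auto
  ultimately show ?thesis by (auto simp: dominates_def)
qed

text \<open>In a combination of vertices, the vertex whose multiple attains the maximum in coordinate \<open>k\<close>
  dominates it there. Conversely, combine the largest multiples of the vertices that lie below \<open>x\<close>.
  For a vertex \<open>q\<close> the coefficient is the minimum of \<open>x\<^sub>j - q\<^sub>j\<close> over \<open>j\<close>, and the multiple touches \<open>x\<close>
  in coordinate \<open>k\<close> iff \<open>q\<close> dominates \<open>x\<close> there.\<close>

lemma point_in_span_iff:
  "point x \<in> trop_span (point a) (point b) (point c) \<longleftrightarrow>
     (\<forall>k. \<exists>q\<in>{a, b, c}. dominates k q x)"
proof
  define comb where "comb l m n k =
    max (l + ereal (a$k)) (max (m + ereal (b$k)) (n + ereal (c$k)))" for l m n k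
  have span: "trop_span (point a) (point b) (point c) =
    {abs_tp2 (comb l m n 1, comb l m n 2, comb l m n 3) | l m n.
       l \<noteq> \<infinity> \<and> m \<noteq> \<infinity> \<and> n \<noteq> \<infinity> \<and> \<not> (l = -\<infinity> \<and> m = -\<infinity> \<and> n = -\<infinity>)}"
    by (simp add: point_def trop_span_abs trop_vec_real trop_scale_def trop_add_def comb_def)
  {
    assume "point x \<in> trop_span (point a) (point b) (point c)"
    then obtain l m n where lmn: "point x = abs_tp2 (comb l m n 1, comb l m n 2, comb l m n 3)"
      "l \<noteq> \<infinity>" "m \<noteq> \<infinity>" "n \<noteq> \<infinity>" "\<not> (l = -\<infinity> \<and> m = -\<infinity> \<and> n = -\<infinity>)"
      unfolding span by blast
    have "\<exists>r::real. comb l m n k = ereal r" for k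
      using lmn(2-5) unfolding comb_def by (cases l; cases m; cases n) (auto simp: max_def)
    then obtain f where f: "comb l m n k = ereal (f k)" for k by metis
    define y where "y = (\<chi> k. f k)"
    have y: "comb l m n k = ereal (y$k)" for k by (simp add: f y_def)
    have "point x = point y" using lmn(1) by (simp add: y point_def)
    hence xy: "x$i - x$j = y$i - y$j" for i j by (rule point_eqD)
    have dom: "dominates k q x"
      if touch: "l' + ereal (q$k) = ereal (y$k)" and below: "\<And>j. l' + ereal (q$j) \<le> ereal (y$j)"
      for k q l'
    proof -
      obtain t where t: "l' = ereal t" using touch by (cases l') auto
      have "q$j - x$j \<le> q$k - x$k" for j
        using touch below[of j] xy[of j k] unfolding t by simp
      thus ?thesis by (simp add: dominates_def)
    qed
    show "\<forall>k. \<exists>q\<in>{a, b, c}. dominates k q x"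
    proof
      fix k
      have le: "l + ereal (a$j) \<le> ereal (y$j)" "m + ereal (b$j) \<le> ereal (y$j)"
        "n + ereal (c$j) \<le> ereal (y$j)" for j
        by (simp_all add: y[symmetric] comb_def le_max_iff_disj)
      have "l + ereal (a$k) = ereal (y$k) \<or> m + ereal (b$k) = ereal (y$k) \<or>
          n + ereal (c$k) = ereal (y$k)"
        unfolding y[symmetric] comb_def by (auto simp: max_def)
      thus "\<exists>q\<in>{a, b, c}. dominates k q x" using dom le by blast
    qed
  next
    assume dom: "\<forall>k. \<exists>q\<in>{a, b, c}. dominates k q x"
    define coef where "coef q = Min (range (\<lambda>j. x$j - q$j))" for q
    have below: "coef q + q$j \<le> x$j" for q j
    proof -
      have "coef q \<le> x$j - q$j" unfolding coef_def by (rule Min_le) auto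
      thus ?thesis by simp
    qed
    have touch: "coef q + q$k = x$k" if "dominates k q x" for q k
    proof -
      have "coef q = x$k - q$k"
        unfolding coef_def
        by (rule Min_eqI) (use that in \<open>auto simp: dominates_def algebra_simps\<close>)
      thus ?thesis by simp
    qed
    have "comb (coef a) (coef b) (coef c) k = ereal (x$k)" for k
    proof -
      have "max (coef a + a$k) (max (coef b + b$k) (coef c + c$k)) = x$k"
        using dom[rule_format, of k] touch[of k a] touch[of k b] touch[of k c]
          below[of a k] below[of b k] below[of c k] by auto
      thus ?thesis by (simp add: comb_def flip: ereal_max)
    qed
    hence "point x = abs_tp2 (comb (coef a) (coef b) (coef c) 1, comb (coef a) (coef b) (coef c) 2,
        comb (coef a) (coef b) (coef c) 3)"
      by (simp add: point_def)
    thus "point x \<in> trop_span (point a) (point b) (point c)"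
      unfolding span
      by (intro CollectI exI[of _ "ereal (coef a)"] exI[of _ "ereal (coef b)"]
          exI[of _ "ereal (coef c)"]) simp
  }
qed


section \<open>The vertices of a good triangle\<close>

definition separated :: "real^3 \<Rightarrow> real^3 \<Rightarrow> real^3 \<Rightarrow> bool" where
  "separated p q r \<longleftrightarrow> (\<exists>i j. i \<noteq> j \<and> dominates i q p \<and> dominates j r p)"

lemma separated_commute: "separated p q r \<longleftrightarrow> separated p r q"
  unfolding separated_def by metis

text \<open>If separation fails, then \<open>q - p\<close> and \<open>r - p\<close> have their maximum at the same single index \<open>i\<close>.
  Computing the intersection of the two lines with this information shows that it differs from \<open>p\<close>:
  coordinate \<open>i\<close> comes out too large in comparison with the others.\<close>

lemma stable_vertex_separated:
  assumes "stable_prod (stable_prod (point r) (point p)) (stable_prod (point p) (point q)) = point p"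
  shows "separated p q r"
proof (rule ccontr)
  assume nsep: "\<not> separated p q r"
  obtain i where i: "dominates i q p" using ex_dominates by blast
  obtain i' where "dominates i' r p" using ex_dominates by blast
  with i nsep have i': "dominates i r p" unfolding separated_def by metis
  have only: "l = i" if "dominates l q p \<or> dominates l r p" for l
    using that i i' nsep unfolding separated_def by metis
  have q: "q$l - p$l < q$i - p$i" if "l \<noteq> i" for l
  proof -
    have "\<not> dominates l q p" using only that by blast
    thus ?thesis using i unfolding dominates_def by (smt (verit))
  qed
  have r: "r$l - p$l < r$i - p$i" if "l \<noteq> i" for l
  proof -
    have "\<not> dominates l r p" using only that by blast
    thus ?thesis using i' unfolding dominates_def by (smt (verit))
  qed
  obtain j k where jk: "i \<noteq> j" "i \<noteq> k" "j \<noteq> k"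
    by (rule ex_other_indices)
  let ?\<beta> = "cross_max r p" and ?\<gamma> = "cross_max p q"
  have "point (cross_max ?\<beta> ?\<gamma>) = point p" using assms by (simp add: stable_prod_point)
  hence "cross_max ?\<beta> ?\<gamma> $ j - cross_max ?\<beta> ?\<gamma> $ i = p$j - p$i" by (rule point_eqD)
  moreover have "cross_max ?\<beta> ?\<gamma> $ i = max (?\<beta>$j + ?\<gamma>$k) (?\<beta>$k + ?\<gamma>$j)"
    by (rule cross_max_nth) (use jk in auto)
  moreover have "cross_max ?\<beta> ?\<gamma> $ j = max (?\<beta>$i + ?\<gamma>$k) (?\<beta>$k + ?\<gamma>$i)"
    by (rule cross_max_nth) (use jk in auto)
  moreover have "?\<beta>$j = r$i + p$k" "?\<gamma>$j = q$i + p$k"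
    using cross_max_nth[of j i k r p] cross_max_nth[of j i k p q] jk q[of k] r[of k] by auto
  moreover have "?\<beta>$k = r$i + p$j" "?\<gamma>$k = q$i + p$j"
    using cross_max_nth[of k i j r p] cross_max_nth[of k i j p q] jk q[of j] r[of j] by auto
  moreover have "?\<beta>$i < r$i - p$i + p$j + p$k" "?\<gamma>$i < q$i - p$i + p$j + p$k"
    using cross_max_nth[of i j k r p] cross_max_nth[of i j k p q] jk q[of j] r[of j] q[of k] r[of k]
    by auto
  ultimately show False by linarith
qed

text \<open>
  Every vertex is dominated by (below) the two others in two different coordinates. The vertices \<open>m\<close> and \<open>p\<close> being
  maximal for \<open>k\<close>, they need both other coordinates \<open>i\<close>, \<open>j\<close> for this; say \<open>p\<close> is above \<open>m\<close> in \<open>i\<close>. As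
  \<open>m\<close> can be above \<open>p\<close> only in \<open>j\<close>, the third vertex \<open>r\<close> is above \<open>p\<close> in \<open>i\<close> and above \<open>m\<close> in \<open>j\<close>. By
  transitivity \<open>r\<close> is above both in \<open>i\<close> and in \<open>j\<close>, and they can be above \<open>r\<close> only in \<open>k\<close>,
  so \<open>r\<close> is not separated.
\<close>

lemma separated_no_two_maximal:
  assumes sep: "separated m p r" "separated p m r" "separated r m p"
    and incomp: "\<not> dominates k m p" "\<not> dominates k p m"
    and max: "dominates k r m \<Longrightarrow> dominates k m r" "dominates k r p \<Longrightarrow> dominates k p r"
  shows False
proof -
  \<comment> \<open>Maximality also allows \<open>r\<close> to be the same point as \<open>v\<close>. Then separation of \<open>u\<close> means that \<open>v\<close> is
    above \<open>u\<close> in both coordinates other than \<open>k\<close>, which leaves none for \<open>u\<close> being above \<open>v\<close>.\<close>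
  have strict: "\<not> dominates k r v"
    if sep_u: "separated u v r" and uv: "\<not> dominates k u v" "\<not> dominates k v u"
      and v: "dominates k r v \<Longrightarrow> dominates k v r" for u v
  proof
    assume rv: "dominates k r v"
    obtain i j where ij: "i \<noteq> j" "dominates i v u" "dominates j r u"
      using sep_u unfolding separated_def by blast
    have "dominates j v r" using dominates_antisym[OF v[OF rv] rv] .
    hence j: "dominates j v u" using ij(3) dominates_trans by blast
    obtain l where l: "dominates l u v" using ex_dominates by blast
    have "l = i \<or> l = j" using index_cases[of i j k l] ij j l uv by metis
    thus False using l ij(2) j uv(2) dominates_antisym by blast
  qed
  have rm: "\<not> dominates k r m" and rp: "\<not> dominates k r p"
    using strict sep(1,2) incomp max by metis+
  obtain i j where ij: "i \<noteq> j" "dominates i p m" "dominates j r m"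
    using sep(1) unfolding separated_def by blast
  have k: "i \<noteq> k" "j \<noteq> k" using ij incomp rm by auto
  obtain i' j' where ij': "i' \<noteq> j'" "dominates i' m p" "dominates j' r p"
    using sep(2) unfolding separated_def by blast
  have "i' \<noteq> k" "j' \<noteq> k" "i' \<noteq> i"
    using ij' ij(2) incomp rp dominates_antisym by blast+
  hence "i' = j" "j' = i" using index_cases[OF ij(1) k] ij'(1) by metis+
  hence mp: "dominates j m p" and rp_i: "dominates i r p" using ij' by auto
  have rm_i: "dominates i r m" and rp_j: "dominates j r p"
    using rp_i ij(2,3) mp dominates_trans by blast+
  have "l = k" if "dominates l m r \<or> dominates l p r" for l
    using index_cases[OF ij(1) k, of l] that rm_i rp_i ij(3) rp_j rm rp dominates_antisym by blast
  thus False using sep(3) unfolding separated_def by blast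
qed

text \<open>A preorder on three elements without a greatest element has two incomparable maximal ones.\<close>

lemma separated_imp_greatest_vertex:
  assumes "separated a b c" "separated b a c" "separated c a b"
  shows "\<exists>q\<in>{a, b, c}. \<forall>r\<in>{a, b, c}. dominates k q r"
proof (rule ccontr)
  assume no_greatest: "\<not> ?thesis"
  let ?R = "dominates k"
  have sep: "separated a c b" "separated b c a" "separated c b a"
    using assms separated_commute by blast+
  have "?R a b \<or> ?R b a \<or> ?R c a \<and> \<not> ?R a c \<or> ?R c b \<and> \<not> ?R b c"
    using separated_no_two_maximal[of a b c k] assms sep by blast
  moreover have "?R a c \<or> ?R c a \<or> ?R b a \<and> \<not> ?R a b \<or> ?R b c \<and> \<not> ?R c b"
    using separated_no_two_maximal[of a c b k] assms sep by blast
  moreover have "?R b c \<or> ?R c b \<or> ?R a b \<and> \<not> ?R b a \<or> ?R a c \<and> \<not> ?R c a"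
    using separated_no_two_maximal[of b c a k] assms sep by blast
  moreover have "\<not> (?R a b \<and> ?R a c)" "\<not> (?R b a \<and> ?R b c)" "\<not> (?R c a \<and> ?R c b)"
    using no_greatest dominates_refl by auto
  ultimately show False
    using dominates_trans[of k a b c] dominates_trans[of k a c b] dominates_trans[of k b a c]
      dominates_trans[of k b c a] dominates_trans[of k c a b] dominates_trans[of k c b a] by argo
qed


section \<open>Convexity\<close>

lemma convex_dominated: "convex {x. dominates k p x}"
proof (rule convexI)
  fix x y :: "real^3" and u v :: real
  assume xy: "x \<in> {x. dominates k p x}" "y \<in> {x. dominates k p x}"
    and uv: "0 \<le> u" "0 \<le> v" "u + v = 1"
  have "u * (x$k - x$j) + v * (y$k - y$j) \<le> p$k - p$j" for j
    by (rule convex_bound_le)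
      (use xy[unfolded dominates_def mem_Collect_eq, THEN spec, of j] uv in linarith)+
  thus "u *\<^sub>R x + v *\<^sub>R y \<in> {x. dominates k p x}"
    by (simp add: dominates_def algebra_simps)
qed

theorem corollary1:
  fixes a b c :: tp2
  assumes "real_point a" and "real_point b" and "real_point c"
    and "good_trop_triangle a b c"
  shows "convex (affine_chart ` trop_span a b c)"
proof -
  obtain x y z where xyz: "a = point x" "b = point y" "c = point z"
    using assms(1-3) by (auto simp: real_point_iff)
  have "separated x y z" "separated y z x" "separated z x y"
    using assms(4) unfolding good_trop_triangle_def stable_join_def stable_inter_line xyz
    by (auto intro: stable_vertex_separated)
  hence "\<forall>k. \<exists>q\<in>{x, y, z}. \<forall>r\<in>{x, y, z}. dominates k q r"
    using separated_imp_greatest_vertex separated_commute by blast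
  then obtain G where G: "\<And>k. G k \<in> {x, y, z}" "\<And>k r. r \<in> {x, y, z} \<Longrightarrow> dominates k (G k) r"
    by metis
  let ?S = "\<Inter>k. {p. dominates k (G k) p}"
  have "(\<exists>q\<in>{x, y, z}. dominates k q p) \<longleftrightarrow> dominates k (G k) p" for k p
    using G dominates_trans by blast
  hence "point p \<in> trop_span a b c \<longleftrightarrow> p \<in> ?S" for p
    by (simp only: xyz point_in_span_iff) simp
  moreover have "\<exists>p. q = point p" if "q \<in> trop_span a b c" for q
    using trop_span_real_point[OF assms(1-3) that] by (simp add: real_point_iff)
  ultimately have "trop_span a b c = point ` ?S" by blast
  hence chart: "affine_chart ` trop_span a b c = (\<lambda>p. (p$1 - p$3, p$2 - p$3)) ` ?S"
    by (simp add: image_image affine_chart_point)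
  have "linear (\<lambda>p::real^3. (p$1 - p$3, p$2 - p$3))"
    by (rule linearI) (auto simp: algebra_simps)
  moreover have "convex ?S" by (intro convex_INT convex_dominated)
  ultimately show ?thesis unfolding chart by (rule convex_linear_image)
qed

end
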